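(* Let $\mathsf{JL}$ be any justification logic from the list in the context and $\mathsf{CS}$ a constant specification for $\mathsf{JL}$. The rules of weakening $$\frac{\Gamma\Rightarrow\Delta}{\varphi,\Gamma\Rightarrow\Delta}\ (LW)\qquad\qquad\frac{\Gamma\Rightarrow\Delta}{\Gamma\Rightarrow\Delta,\varphi}\ (RW),$$ where $\varphi$ is any formula of one of the forms $w\Vvdash A$, $wRv$, $wE(t,A)$, are height-preserving $\mathsf{CS}$-admissible in $\mathsf{G3JL}_{\mathsf{CS}}$.
   Context: Justification logics. Terms are built from justification variables and constants by binary $\cdot,+$ and (depending on the logic) unary $!$, $?$, $\bar{?}$. Formulas are built from propositional variables and $\bot$ by $\neg,\wedge,\vee,\to$ and $t:A$. $\mathsf J$ has axiom schemes: propositional tautologies; $s:A\to(s+t):A$, $s:A\to(t+s):A$; $s:(A\to B)\to(t:A\to(s\cdot t):B)$. A justification logic $\mathsf{JL}$ is $\mathsf J$ extended by at most one of (jT) $t:A\to A$, (jD) $t:\bot\to\bot$, and by any subset of (j4) $t:A\to\,!t:t:A$, (jB) $\neg A\to\bar{?}t:\neg t:A$, (j5) $\neg t:A\to\,?t:\neg t:A$; its language contains $!$ (resp. $\bar{?}$, $?$) exactly when (j4) (resp. (jB), (j5)) is an axiom. A constant specification $\mathsf{CS}$ for $\mathsf{JL}$: if (j4) is not an axiom, a set of formulas $c_n:\dots:c_1:A$ ($n\ge1$, $c_j$ constants, $A$ an axiom instance), closed under passing from $c_n:c_{n-1}:\dots:c_1:A$ to $c_{n-1}:\dots:c_1:A$;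 if (j4) is an axiom, a set of formulas $c:A$ ($c$ a constant, $A$ an axiom instance). Calculus $\mathsf{G3JL}_{\mathsf{CS}}$. Fix a countably infinite set of labels $w,v,u,\dots$. The labeled language has labeled formulas $w\Vvdash A$, relational atoms $wRv$ and evidence atoms $wE(t,A)$ ($A$ a formula, $t$ a term). Sequents $\Gamma\Rightarrow\Delta$ consist of finite multisets of these. Initial sequents: $w\Vvdash P,\Gamma\Rightarrow\Delta,w\Vvdash P$ ($P$ a propositional variable); $w\Vvdash\bot,\Gamma\Rightarrow\Delta$; $wRv,\Gamma\Rightarrow\Delta,wRv$; $wE(t,A),\Gamma\Rightarrow\Delta,wE(t,A)$. Rules (premises / conclusion): (L$\neg$) $\Gamma\Rightarrow\Delta,w\Vvdash A$ / $w\Vvdash\neg A,\Gamma\Rightarrow\Delta$; (R$\neg$) $w\Vvdash A,\Gamma\Rightarrow\Delta$ / $\Gamma\Rightarrow\Delta,w\Vvdash\neg A$; (L$\wedge$) $w\Vvdash A,w\Vvdash B,\Gamma\Rightarrow\Delta$ / $w\Vvdash A\wedge B,\Gamma\Rightarrow\Delta$; (R$\wedge$) $\Gamma\Rightarrow\Delta,w\Vvdash A$ and $\Gamma\Rightarrow\Delta,w\Vvdash B$ / $\Gamma\Rightarrow\Delta,w\Vvdash A\wedge B$; (L$\vee$) $w\Vvdash A,\Gamma\Rightarrow\Delta$ and $w\Vvdash B,\Gamma\Rightarrow\Delta$ / $w\Vvdash A\vee B,\Gamma\Rightarrow\Delta$; (R$\vee$) $\Gamma\Rightarrow\Delta,w\Vvdash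 A,w\Vvdash B$ / $\Gamma\Rightarrow\Delta,w\Vvdash A\vee B$; (L$\to$) $\Gamma\Rightarrow\Delta,w\Vvdash A$ and $w\Vvdash B,\Gamma\Rightarrow\Delta$ / $w\Vvdash A\to B,\Gamma\Rightarrow\Delta$; (R$\to$) $w\Vvdash A,\Gamma\Rightarrow\Delta,w\Vvdash B$ / $\Gamma\Rightarrow\Delta,w\Vvdash A\to B$; (L:) $v\Vvdash A,w\Vvdash t:A,wRv,\Gamma\Rightarrow\Delta$ / $w\Vvdash t:A,wRv,\Gamma\Rightarrow\Delta$; (R:) $wRv,wE(t,A),\Gamma\Rightarrow\Delta,v\Vvdash A$ / $wE(t,A),\Gamma\Rightarrow\Delta,w\Vvdash t:A$, where the eigenlabel $v$ does not occur in the conclusion; (E) $wE(t,A),w\Vvdash t:A,\Gamma\Rightarrow\Delta$ / $w\Vvdash t:A,\Gamma\Rightarrow\Delta$; (El+) $wE(s+t,A),wE(t,A),\Gamma\Rightarrow\Delta$ / $wE(t,A),\Gamma\Rightarrow\Delta$; (Er+) $wE(t+s,A),wE(t,A),\Gamma\Rightarrow\Delta$ / $wE(t,A),\Gamma\Rightarrow\Delta$; (E$\cdot$) $wE(s\cdot t,B),wE(s,A\to B),wE(t,A),\Gamma\Rightarrow\Delta$ / $wE(s,A\to B),wE(t,A),\Gamma\Rightarrow\Delta$; (IAN)/(AN) $wE(c,F),\Gamma\Rightarrow\Delta$ / $\Gamma\Rightarrow\Delta$, for $c:F\in\mathsf{CS}$ ($c$ a constant). If (jT) is an axiom: (Ref)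 $wRw,\Gamma\Rightarrow\Delta$ / $\Gamma\Rightarrow\Delta$. If (jD) is an axiom: (Ser) $wRv,\Gamma\Rightarrow\Delta$ / $\Gamma\Rightarrow\Delta$, where the eigenlabel $v$ does not occur in the conclusion. If (j4) is an axiom: (E!) $wE(!t,t:A),wE(t,A),\Gamma\Rightarrow\Delta$ / $wE(t,A),\Gamma\Rightarrow\Delta$; (Mon) $vE(t,A),wE(t,A),wRv,\Gamma\Rightarrow\Delta$ / $wE(t,A),wRv,\Gamma\Rightarrow\Delta$; (Trans) $wRu,wRv,vRu,\Gamma\Rightarrow\Delta$ / $wRv,vRu,\Gamma\Rightarrow\Delta$. If (jB) is an axiom: (E$\bar{?}$) $w\Vvdash A,\Gamma\Rightarrow\Delta$ and $wE(\bar{?}t,\neg t:A),\Gamma\Rightarrow\Delta$ / $\Gamma\Rightarrow\Delta$; (Sym) $vRw,wRv,\Gamma\Rightarrow\Delta$ / $wRv,\Gamma\Rightarrow\Delta$. If (j5) is an axiom: (SE) $w\Vvdash t:A,wE(t,A),\Gamma\Rightarrow\Delta$ / $wE(t,A),\Gamma\Rightarrow\Delta$; (E?) $wE(t,A),\Gamma\Rightarrow\Delta$ and $wE(?t,\neg t:A),\Gamma\Rightarrow\Delta$ / $\Gamma\Rightarrow\Delta$. The height of a derivation is the maximum number of successive rule applications in it. "Derivable with height $n$" means having a derivation of height at most $n$. A rule is height-preserving $\mathsf{CS}$-admissible if whenever an instance of its premise(s) is derivable in $\mathsf{G3JL}_{\mathsf{CS}}$ with height $n$, then so is the corresponding instance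 of its conclusion. *)

theory Defs
  imports "HOL-Library.Multiset"
begin

section \<open>Justification logics\<close>

text \<open>The alphabets of justification variables, constants and propositional variables are the
  type parameters \<open>'x\<close>, \<open>'c\<close> and \<open>'p\<close>.  The datatypes contain the operations of all logics;
  the language of an individual logic is carved out by \<open>tm_lang\<close> and \<open>fm_lang\<close> below.\<close>

datatype ('x, 'c) tm =
    JVar 'x
  | Const 'c
  | App "('x, 'c) tm" "('x, 'c) tm"  (infixl "\<^bold>\<cdot>" 101)
  | Sum "('x, 'c) tm" "('x, 'c) tm"  (infixl "\<^bold>+" 100)
  | Bang "('x, 'c) tm"
  | Quest "('x, 'c) tm"
  | QuestBar "('x, 'c) tm"

datatype ('x, 'c, 'p) fm =
    PVar 'p
  | Bot  ("\<^bold>\<bottom>")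
  | Neg "('x, 'c, 'p) fm"  ("\<^bold>\<not> _" [85] 85)
  | Conj "('x, 'c, 'p) fm" "('x, 'c, 'p) fm"  (infixr "\<^bold>\<and>" 80)
  | Disj "('x, 'c, 'p) fm" "('x, 'c, 'p) fm"  (infixr "\<^bold>\<or>" 75)
  | Imp "('x, 'c, 'p) fm" "('x, 'c, 'p) fm"  (infixr "\<^bold>\<rightarrow>" 70)
  | Just "('x, 'c) tm" "('x, 'c, 'p) fm"  (infixr "\<^bold>:" 90)

text \<open>A justification logic is given by the set of schemes it adds to \<open>J\<close>.\<close>

datatype scheme = JT | JD | J4 | JB | J5

definition justification_logic :: "scheme set \<Rightarrow> bool" where
  "justification_logic L \<longleftrightarrow> \<not> (JT \<in> L \<and> JD \<in> L)"

primrec tm_lang :: "scheme set \<Rightarrow> ('x, 'c) tm \<Rightarrow> bool" where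
  "tm_lang L (JVar x) \<longleftrightarrow> True"
| "tm_lang L (Const c) \<longleftrightarrow> True"
| "tm_lang L (s \<^bold>\<cdot> t) \<longleftrightarrow> tm_lang L s \<and> tm_lang L t"
| "tm_lang L (s \<^bold>+ t) \<longleftrightarrow> tm_lang L s \<and> tm_lang L t"
| "tm_lang L (Bang t) \<longleftrightarrow> J4 \<in> L \<and> tm_lang L t"
| "tm_lang L (Quest t) \<longleftrightarrow> J5 \<in> L \<and> tm_lang L t"
| "tm_lang L (QuestBar t) \<longleftrightarrow> JB \<in> L \<and> tm_lang L t"

primrec fm_lang :: "scheme set \<Rightarrow> ('x, 'c, 'p) fm \<Rightarrow> bool" where
  "fm_lang L (PVar p) \<longleftrightarrow> True"
| "fm_lang L \<^bold>\<bottom> \<longleftrightarrow> True"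
| "fm_lang L (\<^bold>\<not> A) \<longleftrightarrow> fm_lang L A"
| "fm_lang L (A \<^bold>\<and> B) \<longleftrightarrow> fm_lang L A \<and> fm_lang L B"
| "fm_lang L (A \<^bold>\<or> B) \<longleftrightarrow> fm_lang L A \<and> fm_lang L B"
| "fm_lang L (A \<^bold>\<rightarrow> B) \<longleftrightarrow> fm_lang L A \<and> fm_lang L B"
| "fm_lang L (t \<^bold>: A) \<longleftrightarrow> tm_lang L t \<and> fm_lang L A"

text \<open>Propositional tautologies: formulas \<open>t \<^bold>: A\<close> are treated as atoms.\<close>

primrec prop_eval ::
  "('p \<Rightarrow> bool) \<Rightarrow> (('x, 'c) tm \<Rightarrow> ('x, 'c, 'p) fm \<Rightarrow> bool) \<Rightarrow> ('x, 'c, 'p) fm \<Rightarrow> bool" where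
  "prop_eval I J (PVar p) \<longleftrightarrow> I p"
| "prop_eval I J \<^bold>\<bottom> \<longleftrightarrow> False"
| "prop_eval I J (\<^bold>\<not> A) \<longleftrightarrow> \<not> prop_eval I J A"
| "prop_eval I J (A \<^bold>\<and> B) \<longleftrightarrow> prop_eval I J A \<and> prop_eval I J B"
| "prop_eval I J (A \<^bold>\<or> B) \<longleftrightarrow> prop_eval I J A \<or> prop_eval I J B"
| "prop_eval I J (A \<^bold>\<rightarrow> B) \<longleftrightarrow> (prop_eval I J A \<longrightarrow> prop_eval I J B)"
| "prop_eval I J (t \<^bold>: A) \<longleftrightarrow> J t A"

definition tautology :: "('x, 'c, 'p) fm \<Rightarrow> bool" where
  "tautology A \<longleftrightarrow> (\<forall>I J. prop_eval I J A)"

inductive scheme_instance :: "scheme set \<Rightarrow> ('x, 'c, 'p) fm \<Rightarrow> bool" for L where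
  "tautology A \<Longrightarrow> scheme_instance L A"
| "scheme_instance L (s \<^bold>: A \<^bold>\<rightarrow> (s \<^bold>+ t) \<^bold>: A)"
| "scheme_instance L (s \<^bold>: A \<^bold>\<rightarrow> (t \<^bold>+ s) \<^bold>: A)"
| "scheme_instance L (s \<^bold>: (A \<^bold>\<rightarrow> B) \<^bold>\<rightarrow> (t \<^bold>: A \<^bold>\<rightarrow> (s \<^bold>\<cdot> t) \<^bold>: B))"
| "JT \<in> L \<Longrightarrow> scheme_instance L (t \<^bold>: A \<^bold>\<rightarrow> A)"
| "JD \<in> L \<Longrightarrow> scheme_instance L (t \<^bold>: \<^bold>\<bottom> \<^bold>\<rightarrow> \<^bold>\<bottom>)"
| "J4 \<in> L \<Longrightarrow> scheme_instance L (t \<^bold>: A \<^bold>\<rightarrow> Bang t \<^bold>: t \<^bold>: A)"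
| "JB \<in> L \<Longrightarrow> scheme_instance L (\<^bold>\<not> A \<^bold>\<rightarrow> QuestBar t \<^bold>: (\<^bold>\<not> t \<^bold>: A))"
| "J5 \<in> L \<Longrightarrow> scheme_instance L (\<^bold>\<not> t \<^bold>: A \<^bold>\<rightarrow> Quest t \<^bold>: (\<^bold>\<not> t \<^bold>: A))"

definition axiom_instance :: "scheme set \<Rightarrow> ('x, 'c, 'p) fm \<Rightarrow> bool" where
  "axiom_instance L A \<longleftrightarrow> fm_lang L A \<and> scheme_instance L A"

text \<open>\<open>const_chain [c\<^sub>n, \<dots>, c\<^sub>1] A\<close> is the formula \<open>c\<^sub>n : \<dots> : c\<^sub>1 : A\<close>.\<close>

definition const_chain :: "'c list \<Rightarrow> ('x, 'c, 'p) fm \<Rightarrow> ('x, 'c, 'p) fm" where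
  "const_chain cs A = foldr (\<lambda>c F. Const c \<^bold>: F) cs A"

definition constant_specification :: "scheme set \<Rightarrow> ('x, 'c, 'p) fm set \<Rightarrow> bool" where
  "constant_specification L CS \<longleftrightarrow>
    (if J4 \<in> L then
       \<forall>F\<in>CS. \<exists>c A. axiom_instance L A \<and> F = Const c \<^bold>: A
     else
       (\<forall>F\<in>CS. \<exists>cs A. cs \<noteq> [] \<and> axiom_instance L A \<and> F = const_chain cs A) \<and>
       (\<forall>c cs A. cs \<noteq> [] \<longrightarrow> axiom_instance L A \<longrightarrow>
          const_chain (c # cs) A \<in> CS \<longrightarrow> const_chain cs A \<in> CS))"


section \<open>The labeled sequent calculus\<close>

type_synonym label = nat

datatype ('x, 'c, 'p) lfm =
    Forces label "('x, 'c, 'p) fm"  (infix "\<tturnstile>" 65)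
  | Rel label label
  | Ev label "('x, 'c) tm" "('x, 'c, 'p) fm"

datatype ('x, 'c, 'p) sequent =
  Sequent "('x, 'c, 'p) lfm multiset" "('x, 'c, 'p) lfm multiset"  (infix "\<Rrightarrow>" 55)

primrec lfm_lang :: "scheme set \<Rightarrow> ('x, 'c, 'p) lfm \<Rightarrow> bool" where
  "lfm_lang L (w \<tturnstile> A) \<longleftrightarrow> fm_lang L A"
| "lfm_lang L (Rel w v) \<longleftrightarrow> True"
| "lfm_lang L (Ev w t A) \<longleftrightarrow> tm_lang L t \<and> fm_lang L A"

primrec sequent_lang :: "scheme set \<Rightarrow> ('x, 'c, 'p) sequent \<Rightarrow> bool" where
  "sequent_lang L (\<Gamma> \<Rrightarrow> \<Delta>) \<longleftrightarrow> (\<forall>\<phi>\<in>#\<Gamma> + \<Delta>. lfm_lang L \<phi>)"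

primrec lfm_labels :: "('x, 'c, 'p) lfm \<Rightarrow> label set" where
  "lfm_labels (w \<tturnstile> A) = {w}"
| "lfm_labels (Rel w v) = {w, v}"
| "lfm_labels (Ev w t A) = {w}"

primrec sequent_labels :: "('x, 'c, 'p) sequent \<Rightarrow> label set" where
  "sequent_labels (\<Gamma> \<Rrightarrow> \<Delta>) = (\<Union>\<phi>\<in>set_mset (\<Gamma> + \<Delta>). lfm_labels \<phi>)"

inductive initial :: "('x, 'c, 'p) sequent \<Rightarrow> bool" where
  "initial ({#w \<tturnstile> PVar p#} + \<Gamma> \<Rrightarrow> \<Delta> + {#w \<tturnstile> PVar p#})"
| "initial ({#w \<tturnstile> \<^bold>\<bottom>#} + \<Gamma> \<Rrightarrow> \<Delta>)"
| "initial ({#Rel w v#} + \<Gamma> \<Rrightarrow> \<Delta> + {#Rel w v#})"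
| "initial ({#Ev w t A#} + \<Gamma> \<Rrightarrow> \<Delta> + {#Ev w t A#})"

text \<open>\<open>inference L CS Ps S\<close>: the list \<open>Ps\<close> of premises and the conclusion \<open>S\<close> form an instance
  of one of the rules.\<close>

inductive inference ::
  "scheme set \<Rightarrow> ('x, 'c, 'p) fm set \<Rightarrow> ('x, 'c, 'p) sequent list \<Rightarrow> ('x, 'c, 'p) sequent \<Rightarrow> bool"
  for L CS where
  LNeg: "inference L CS
    [\<Gamma> \<Rrightarrow> \<Delta> + {#w \<tturnstile> A#}]
    ({#w \<tturnstile> \<^bold>\<not> A#} + \<Gamma> \<Rrightarrow> \<Delta>)"
| RNeg: "inference L CS
    [{#w \<tturnstile> A#} + \<Gamma> \<Rrightarrow> \<Delta>]
    (\<Gamma> \<Rrightarrow> \<Delta> + {#w \<tturnstile> \<^bold>\<not> A#})"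
| LConj: "inference L CS
    [{#w \<tturnstile> A, w \<tturnstile> B#} + \<Gamma> \<Rrightarrow> \<Delta>]
    ({#w \<tturnstile> A \<^bold>\<and> B#} + \<Gamma> \<Rrightarrow> \<Delta>)"
| RConj: "inference L CS
    [\<Gamma> \<Rrightarrow> \<Delta> + {#w \<tturnstile> A#}, \<Gamma> \<Rrightarrow> \<Delta> + {#w \<tturnstile> B#}]
    (\<Gamma> \<Rrightarrow> \<Delta> + {#w \<tturnstile> A \<^bold>\<and> B#})"
| LDisj: "inference L CS
    [{#w \<tturnstile> A#} + \<Gamma> \<Rrightarrow> \<Delta>, {#w \<tturnstile> B#} + \<Gamma> \<Rrightarrow> \<Delta>]
    ({#w \<tturnstile> A \<^bold>\<or> B#} + \<Gamma> \<Rrightarrow> \<Delta>)"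
| RDisj: "inference L CS
    [\<Gamma> \<Rrightarrow> \<Delta> + {#w \<tturnstile> A, w \<tturnstile> B#}]
    (\<Gamma> \<Rrightarrow> \<Delta> + {#w \<tturnstile> A \<^bold>\<or> B#})"
| LImp: "inference L CS
    [\<Gamma> \<Rrightarrow> \<Delta> + {#w \<tturnstile> A#}, {#w \<tturnstile> B#} + \<Gamma> \<Rrightarrow> \<Delta>]
    ({#w \<tturnstile> A \<^bold>\<rightarrow> B#} + \<Gamma> \<Rrightarrow> \<Delta>)"
| RImp: "inference L CS
    [{#w \<tturnstile> A#} + \<Gamma> \<Rrightarrow> \<Delta> + {#w \<tturnstile> B#}]
    (\<Gamma> \<Rrightarrow> \<Delta> + {#w \<tturnstile> A \<^bold>\<rightarrow> B#})"
| LJust: "inference L CS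
    [{#v \<tturnstile> A, w \<tturnstile> t \<^bold>: A, Rel w v#} + \<Gamma> \<Rrightarrow> \<Delta>]
    ({#w \<tturnstile> t \<^bold>: A, Rel w v#} + \<Gamma> \<Rrightarrow> \<Delta>)"
| RJust: "v \<notin> sequent_labels ({#Ev w t A#} + \<Gamma> \<Rrightarrow> \<Delta> + {#w \<tturnstile> t \<^bold>: A#}) \<Longrightarrow> inference L CS
    [{#Rel w v, Ev w t A#} + \<Gamma> \<Rrightarrow> \<Delta> + {#v \<tturnstile> A#}]
    ({#Ev w t A#} + \<Gamma> \<Rrightarrow> \<Delta> + {#w \<tturnstile> t \<^bold>: A#})"
| E: "inference L CS
    [{#Ev w t A, w \<tturnstile> t \<^bold>: A#} + \<Gamma> \<Rrightarrow> \<Delta>]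
    ({#w \<tturnstile> t \<^bold>: A#} + \<Gamma> \<Rrightarrow> \<Delta>)"
| ElSum: "inference L CS
    [{#Ev w (s \<^bold>+ t) A, Ev w t A#} + \<Gamma> \<Rrightarrow> \<Delta>]
    ({#Ev w t A#} + \<Gamma> \<Rrightarrow> \<Delta>)"
| ErSum: "inference L CS
    [{#Ev w (t \<^bold>+ s) A, Ev w t A#} + \<Gamma> \<Rrightarrow> \<Delta>]
    ({#Ev w t A#} + \<Gamma> \<Rrightarrow> \<Delta>)"
| EApp: "inference L CS
    [{#Ev w (s \<^bold>\<cdot> t) B, Ev w s (A \<^bold>\<rightarrow> B), Ev w t A#} + \<Gamma> \<Rrightarrow> \<Delta>]
    ({#Ev w s (A \<^bold>\<rightarrow> B), Ev w t A#} + \<Gamma> \<Rrightarrow> \<Delta>)"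
| AN: "Const c \<^bold>: F \<in> CS \<Longrightarrow> inference L CS
    [{#Ev w (Const c) F#} + \<Gamma> \<Rrightarrow> \<Delta>]
    (\<Gamma> \<Rrightarrow> \<Delta>)"
| Ref: "JT \<in> L \<Longrightarrow> inference L CS
    [{#Rel w w#} + \<Gamma> \<Rrightarrow> \<Delta>]
    (\<Gamma> \<Rrightarrow> \<Delta>)"
| Ser: "JD \<in> L \<Longrightarrow> v \<notin> sequent_labels (\<Gamma> \<Rrightarrow> \<Delta>) \<Longrightarrow> inference L CS
    [{#Rel w v#} + \<Gamma> \<Rrightarrow> \<Delta>]
    (\<Gamma> \<Rrightarrow> \<Delta>)"
| EBang: "J4 \<in> L \<Longrightarrow> inference L CS
    [{#Ev w (Bang t) (t \<^bold>: A), Ev w t A#} + \<Gamma> \<Rrightarrow> \<Delta>]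
    ({#Ev w t A#} + \<Gamma> \<Rrightarrow> \<Delta>)"
| Mon: "J4 \<in> L \<Longrightarrow> inference L CS
    [{#Ev v t A, Ev w t A, Rel w v#} + \<Gamma> \<Rrightarrow> \<Delta>]
    ({#Ev w t A, Rel w v#} + \<Gamma> \<Rrightarrow> \<Delta>)"
| Trans: "J4 \<in> L \<Longrightarrow> inference L CS
    [{#Rel w u, Rel w v, Rel v u#} + \<Gamma> \<Rrightarrow> \<Delta>]
    ({#Rel w v, Rel v u#} + \<Gamma> \<Rrightarrow> \<Delta>)"
| EQuestBar: "JB \<in> L \<Longrightarrow> inference L CS
    [{#w \<tturnstile> A#} + \<Gamma> \<Rrightarrow> \<Delta>, {#Ev w (QuestBar t) (\<^bold>\<not> t \<^bold>: A)#} + \<Gamma> \<Rrightarrow> \<Delta>]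
    (\<Gamma> \<Rrightarrow> \<Delta>)"
| Sym: "JB \<in> L \<Longrightarrow> inference L CS
    [{#Rel v w, Rel w v#} + \<Gamma> \<Rrightarrow> \<Delta>]
    ({#Rel w v#} + \<Gamma> \<Rrightarrow> \<Delta>)"
| SE: "J5 \<in> L \<Longrightarrow> inference L CS
    [{#w \<tturnstile> t \<^bold>: A, Ev w t A#} + \<Gamma> \<Rrightarrow> \<Delta>]
    ({#Ev w t A#} + \<Gamma> \<Rrightarrow> \<Delta>)"
| EQuest: "J5 \<in> L \<Longrightarrow> inference L CS
    [{#Ev w t A#} + \<Gamma> \<Rrightarrow> \<Delta>, {#Ev w (Quest t) (\<^bold>\<not> t \<^bold>: A)#} + \<Gamma> \<Rrightarrow> \<Delta>]
    (\<Gamma> \<Rrightarrow> \<Delta>)"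

datatype ('x, 'c, 'p) tree =
    Initial "('x, 'c, 'p) sequent"
  | Infer "('x, 'c, 'p) sequent" "('x, 'c, 'p) tree list"

primrec endsequent :: "('x, 'c, 'p) tree \<Rightarrow> ('x, 'c, 'p) sequent" where
  "endsequent (Initial S) = S"
| "endsequent (Infer S ds) = S"

text \<open>No rule is premise-free, so the maximum below is over a nonempty set in every derivation.\<close>

fun height :: "('x, 'c, 'p) tree \<Rightarrow> nat" where
  "height (Initial S) = 0"
| "height (Infer S ds) = Suc (Max (height ` set ds))"

text \<open>All sequents of a derivation are required to belong to the language of the logic \<open>L\<close>.\<close>

inductive derivation ::
  "scheme set \<Rightarrow> ('x, 'c, 'p) fm set \<Rightarrow> ('x, 'c, 'p) tree \<Rightarrow> bool" for L CS where
  "initial S \<Longrightarrow> sequent_lang L S \<Longrightarrow> derivation L CS (Initial S)"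
| "inference L CS (map endsequent ds) S \<Longrightarrow> sequent_lang L S \<Longrightarrow>
   (\<forall>d\<in>set ds. derivation L CS d) \<Longrightarrow> derivation L CS (Infer S ds)"

definition derivable_with_height ::
  "scheme set \<Rightarrow> ('x, 'c, 'p) fm set \<Rightarrow> nat \<Rightarrow> ('x, 'c, 'p) sequent \<Rightarrow> bool" where
  "derivable_with_height L CS n S \<longleftrightarrow>
    (\<exists>d. derivation L CS d \<and> endsequent d = S \<and> height d \<le> n)"

text \<open>A rule is represented by the relation between the premises and the conclusion of its
  instances.\<close>

definition hp_admissible ::
  "scheme set \<Rightarrow> ('x, 'c, 'p) fm set \<Rightarrow>
   (('x, 'c, 'p) sequent list \<Rightarrow> ('x, 'c, 'p) sequent \<Rightarrow> bool) \<Rightarrow> bool" where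
  "hp_admissible L CS R \<longleftrightarrow>
    (\<forall>Ps S n. R Ps S \<longrightarrow> (\<forall>P\<in>set Ps. derivable_with_height L CS n P) \<longrightarrow>
       derivable_with_height L CS n S)"

inductive LW :: "scheme set \<Rightarrow> ('x, 'c, 'p) sequent list \<Rightarrow> ('x, 'c, 'p) sequent \<Rightarrow> bool"
  for L where
  "lfm_lang L \<phi> \<Longrightarrow> LW L [\<Gamma> \<Rrightarrow> \<Delta>] ({#\<phi>#} + \<Gamma> \<Rrightarrow> \<Delta>)"

inductive RW :: "scheme set \<Rightarrow> ('x, 'c, 'p) sequent list \<Rightarrow> ('x, 'c, 'p) sequent \<Rightarrow> bool"
  for L where
  "lfm_lang L \<phi> \<Longrightarrow> RW L [\<Gamma> \<Rrightarrow> \<Delta>] (\<Gamma> \<Rrightarrow> \<Delta> + {#\<phi>#})"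

end

theory Submission imports Defs begin

text \<open>Adding a labeled formula to every sequent of a derivation keeps all rules intact except
  the two with an eigenlabel, \<open>RJust\<close> and \<open>Ser\<close>: the new formula may contain their eigenlabel.
  The eigenlabel then has to be renamed in the subderivation above the rule, which is usually
  done by a separate lemma on height-preserving substitution of labels.

  Here substitution and weakening are proved together.  The calculus is closed under every map
  \<open>f\<close> of labels, injective or not, followed by the addition of arbitrary contexts, because each
  rule mentions labels only as parameters and is otherwise context-independent.  At an eigenlabel
  rule with eigenlabel \<open>v\<close> the premise is transformed with \<open>f(v := u)\<close> for a label \<open>u\<close> fresh for
  the transformed conclusion; since \<open>v\<close> does not occur in the original conclusion, \<open>f(v := u)\<close>
  and \<open>f\<close> act on it alike (\<open>inference_relabel_weaken\<close>).  As the map is universally quantified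
  in the induction on derivations (\<open>derivation_relabel_weaken\<close>), its change from a rule to its
  premises is harmless, and the resulting derivation has the shape, hence the height, of the given
  one.  Weakening is the case where \<open>f\<close> is the identity.\<close>

primrec relabel :: "(label \<Rightarrow> label) \<Rightarrow> ('x, 'c, 'p) lfm \<Rightarrow> ('x, 'c, 'p) lfm" where
  "relabel f (w \<tturnstile> A) = f w \<tturnstile> A"
| "relabel f (Rel w v) = Rel (f w) (f v)"
| "relabel f (Ev w t A) = Ev (f w) t A"

primrec relabel_weaken ::
  "('x, 'c, 'p) lfm multiset \<Rightarrow> ('x, 'c, 'p) lfm multiset \<Rightarrow> (label \<Rightarrow> label) \<Rightarrow>
   ('x, 'c, 'p) sequent \<Rightarrow> ('x, 'c, 'p) sequent" where
  "relabel_weaken \<Phi> \<Psi> f (\<Gamma> \<Rrightarrow> \<Delta>) =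
    (image_mset (relabel f) \<Gamma> + \<Phi> \<Rrightarrow> image_mset (relabel f) \<Delta> + \<Psi>)"

lemma relabel_id [simp]: "relabel id = (id :: ('x, 'c, 'p) lfm \<Rightarrow> _)"
proof
  show "relabel id \<phi> = id \<phi>" for \<phi> :: "('x, 'c, 'p) lfm"
    by (cases \<phi>) auto
qed

lemma lfm_lang_relabel [simp]: "lfm_lang L (relabel f \<phi>) \<longleftrightarrow> lfm_lang L \<phi>"
  by (cases \<phi>) auto

lemma relabel_cong:
  "(\<And>w. w \<in> lfm_labels \<phi> \<Longrightarrow> f w = g w) \<Longrightarrow> relabel f \<phi> = relabel g \<phi>"
  by (cases \<phi>) auto

lemma image_mset_relabel_upd:
  "v \<notin> (\<Union>\<phi>\<in>set_mset \<Gamma>. lfm_labels \<phi>) \<Longrightarrow>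
    image_mset (relabel (f(v := u))) \<Gamma> = image_mset (relabel f) \<Gamma>"
  by (intro image_mset_cong relabel_cong) auto

lemma finite_sequent_labels:
  fixes S :: "('x, 'c, 'p) sequent"
  shows "finite (sequent_labels S)"
proof -
  have "finite (lfm_labels \<phi>)" for \<phi> :: "('x, 'c, 'p) lfm"
    by (cases \<phi>) auto
  then show ?thesis
    by (cases S) auto
qed

lemma sequent_lang_relabel_weaken:
  assumes "sequent_lang L S" "\<forall>\<phi>\<in>#\<Phi> + \<Psi>. lfm_lang L \<phi>"
  shows "sequent_lang L (relabel_weaken \<Phi> \<Psi> f S)"
  using assms by (cases S) auto

lemma initial_relabel_weaken: "initial S \<Longrightarrow> initial (relabel_weaken \<Phi> \<Psi> f S)"
  by (induction rule: initial.induct) (auto intro: initial.intros[simplified])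

text \<open>The relabeling of the premises is allowed to differ from that of the conclusion: only so
  can the eigenlabel condition be maintained when \<open>f\<close> is not injective or the added contexts
  contain the eigenlabel.\<close>

lemma inference_relabel_weaken:
  assumes "inference L CS Ps S"
  shows "\<exists>g. inference L CS (map (relabel_weaken \<Phi> \<Psi> g) Ps) (relabel_weaken \<Phi> \<Psi> f S)"
  using assms
proof cases
  case (RJust v w t A \<Gamma> \<Delta>)
  obtain u where u: "u \<notin> sequent_labels (relabel_weaken \<Phi> \<Psi> f S)"
    using ex_new_if_finite[OF infinite_UNIV_nat finite_sequent_labels] by blast
  have "v \<noteq> w" and
    "image_mset (relabel (f(v := u))) \<Gamma> = image_mset (relabel f) \<Gamma>"
    "image_mset (relabel (f(v := u))) \<Delta> = image_mset (relabel f) \<Delta>"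
    using RJust(3) by (auto intro!: image_mset_relabel_upd)
  then have "inference L CS (map (relabel_weaken \<Phi> \<Psi> (f(v := u))) Ps) (relabel_weaken \<Phi> \<Psi> f S)"
    using u inference.RJust[of u "f w" t A "image_mset (relabel f) \<Gamma> + \<Phi>"
        "image_mset (relabel f) \<Delta> + \<Psi>" L CS]
    by (simp add: RJust(1,2))
  then show ?thesis
    by blast
next
  case (Ser v \<Gamma> \<Delta> w)
  obtain u where u: "u \<notin> sequent_labels (relabel_weaken \<Phi> \<Psi> f S)"
    using ex_new_if_finite[OF infinite_UNIV_nat finite_sequent_labels] by blast
  have
    "image_mset (relabel (f(v := u))) \<Gamma> = image_mset (relabel f) \<Gamma>"
    "image_mset (relabel (f(v := u))) \<Delta> = image_mset (relabel f) \<Delta>"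
    using Ser(4) by (auto intro!: image_mset_relabel_upd)
  \<comment> \<open>The label \<open>w\<close> need not occur in the conclusion and may be the eigenlabel itself,
    so the updated map is applied to it as well.\<close>
  then have "inference L CS (map (relabel_weaken \<Phi> \<Psi> (f(v := u))) Ps) (relabel_weaken \<Phi> \<Psi> f S)"
    using u Ser(3) inference.Ser[of L u "image_mset (relabel f) \<Gamma> + \<Phi>"
        "image_mset (relabel f) \<Delta> + \<Psi>" CS "(f(v := u)) w"]
    by (simp add: Ser(1,2) del: fun_upd_apply add: fun_upd_same)
  then show ?thesis
    by blast
qed (rule exI[of _ f], simp, (rule inference.intros[simplified]; assumption))+

lemma derivation_relabel_weaken:
  assumes "derivation L CS d" and lang: "\<forall>\<phi>\<in>#\<Phi> + \<Psi>. lfm_lang L \<phi>"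
  shows "\<exists>d'. derivation L CS d' \<and> endsequent d' = relabel_weaken \<Phi> \<Psi> f (endsequent d) \<and>
    height d' = height d"
  using assms(1)
proof (induction arbitrary: f)
  case (1 S)
  then have "derivation L CS (Initial (relabel_weaken \<Phi> \<Psi> f S))"
    using lang by (intro derivation.intros initial_relabel_weaken sequent_lang_relabel_weaken)
  then show ?case
    by fastforce
next
  case (2 ds S)
  obtain g where
    g: "inference L CS (map (relabel_weaken \<Phi> \<Psi> g) (map endsequent ds)) (relabel_weaken \<Phi> \<Psi> f S)"
    using inference_relabel_weaken[OF 2(1)] by blast
  have "\<forall>d\<in>set ds. \<exists>d'. derivation L CS d' \<and>
      endsequent d' = relabel_weaken \<Phi> \<Psi> g (endsequent d) \<and> height d' = height d"
    using 2(3) by blast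
  then obtain h where h: "\<forall>d\<in>set ds. derivation L CS (h d) \<and>
      endsequent (h d) = relabel_weaken \<Phi> \<Psi> g (endsequent d) \<and> height (h d) = height d"
    by metis
  have "map endsequent (map h ds) = map (relabel_weaken \<Phi> \<Psi> g) (map endsequent ds)"
    using h by simp
  with g have "inference L CS (map endsequent (map h ds)) (relabel_weaken \<Phi> \<Psi> f S)"
    by (simp only:)
  then have "derivation L CS (Infer (relabel_weaken \<Phi> \<Psi> f S) (map h ds))"
    using h sequent_lang_relabel_weaken[OF 2(2) lang] by (intro derivation.intros) auto
  moreover have "height ` set (map h ds) = height ` set ds"
    using h by (simp add: image_image)
  ultimately show ?case
    by (intro exI[of _ "Infer (relabel_weaken \<Phi> \<Psi> f S) (map h ds)"]) simp
qed

lemma derivable_with_height_weaken: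
  assumes "derivable_with_height L CS n (\<Gamma> \<Rrightarrow> \<Delta>)" "\<forall>\<phi>\<in>#\<Phi> + \<Psi>. lfm_lang L \<phi>"
  shows "derivable_with_height L CS n (\<Gamma> + \<Phi> \<Rrightarrow> \<Delta> + \<Psi>)"
proof -
  obtain d where "derivation L CS d" "endsequent d = \<Gamma> \<Rrightarrow> \<Delta>" "height d \<le> n"
    using assms(1) unfolding derivable_with_height_def by blast
  then show ?thesis
    using derivation_relabel_weaken[OF _ assms(2), of CS d id]
    unfolding derivable_with_height_def by auto
qed

theorem theorem7p1:
  fixes L :: "scheme set" and CS :: "('x, 'c, 'p) fm set"
  assumes "justification_logic L" and "constant_specification L CS"
  shows "hp_admissible L CS (LW L) \<and> hp_admissible L CS (RW L)"
proof
  show "hp_admissible L CS (LW L)"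
    unfolding hp_admissible_def
  proof (intro allI impI)
    fix Ps n and S :: "('x, 'c, 'p) sequent"
    assume "LW L Ps S" "\<forall>P\<in>set Ps. derivable_with_height L CS n P"
    then show "derivable_with_height L CS n S"
      by cases (use derivable_with_height_weaken[of L CS n _ _ "{#_#}" "{#}"] in simp)
  qed
  show "hp_admissible L CS (RW L)"
    unfolding hp_admissible_def
  proof (intro allI impI)
    fix Ps n and S :: "('x, 'c, 'p) sequent"
    assume "RW L Ps S" "\<forall>P\<in>set Ps. derivable_with_height L CS n P"
    then show "derivable_with_height L CS n S"
      by cases (use derivable_with_height_weaken[of L CS n _ _ "{#}" "{#_#}"] in simp)
  qed
qed

end
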